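(* For the family $\mathcal{R} = \mathcal{R}_{\rm BL} \cup \mathcal{R}_{\rm TL}$ of all bottomless and topless rectangles, we have $m_{\mathcal{R}}(k) \leq O(k^{8.75})$ for all $k$; i.e., there is a constant $C$ such that $m_{\mathcal{R}}(k) \leq C k^{8.75}$ for all $k \geq 1$.
   Context: $\mathcal{R}_{\rm BL} = \{\{(x,y) : a_1 \leq x \leq a_2,\ y \leq b\} : a_1,a_2,b \in \mathbb{R}\}$ and $\mathcal{R}_{\rm TL} = \{\{(x,y) : a_1 \leq x \leq a_2,\ y \geq b\} : a_1,a_2,b \in \mathbb{R}\}$. For finite $V \subset \mathbb{R}^2$, $\mathcal{H}(V,\mathcal{R},m)$ is the hypergraph on $V$ whose hyperedges are the sets $V \cap R$, $R \in \mathcal{R}$, of size exactly $m$. A $k$-coloring is polychromatic if every hyperedge contains all $k$ colors. Point sets are in general position (pairwise distinct $x$-coordinates, $y$-coordinates and values $x+y$). $m_{\mathcal{R}}(k)$ is the smallest $m$ such that for every finite $V$ in general position $\mathcal{H}(V,\mathcal{R},m)$ admits a polychromatic $k$-coloring. *)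

theory Defs
  imports Complex_Main
begin

type_synonym point = "real \<times> real"

definition R_BL :: "point set set" where
  "R_BL = {{(x, y). a1 \<le> x \<and> x \<le> a2 \<and> y \<le> b} | a1 a2 b. True}"

definition R_TL :: "point set set" where
  "R_TL = {{(x, y). a1 \<le> x \<and> x \<le> a2 \<and> y \<ge> b} | a1 a2 b. True}"

definition hyperedges :: "point set \<Rightarrow> point set set \<Rightarrow> nat \<Rightarrow> point set set" where
  "hyperedges V \<R> m = {V \<inter> S | S. S \<in> \<R> \<and> card (V \<inter> S) = m}"

definition polychromatic :: "point set \<Rightarrow> point set set \<Rightarrow> nat \<Rightarrow> (point \<Rightarrow> nat) \<Rightarrow> bool" where
  "polychromatic V H k c \<longleftrightarrow> (\<forall>v\<in>V. c v < k) \<and> (\<forall>e\<in>H. {0..<k} \<subseteq> c ` e)"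

definition general_position :: "point set \<Rightarrow> bool" where
  "general_position V \<longleftrightarrow> inj_on fst V \<and> inj_on snd V \<and> inj_on (\<lambda>p. fst p + snd p) V"

definition admits_poly :: "point set set \<Rightarrow> nat \<Rightarrow> nat \<Rightarrow> bool" where
  "admits_poly \<R> k m \<longleftrightarrow>
     (\<forall>V. finite V \<and> general_position V \<longrightarrow> (\<exists>c. polychromatic V (hyperedges V \<R> m) k c))"

text \<open>m_R(k): the smallest such m (meaningful when some m exists).\<close>
definition m_R :: "point set set \<Rightarrow> nat \<Rightarrow> nat" where
  "m_R \<R> k = (LEAST m. admits_poly \<R> k m)"

end

theory Submission
  imports Defs
begin

text \<open>
  The bound obtained is linear, \<open>12 k - 8\<close>. The points are split into a set \<open>D\<close> meeting every
  bottomless rectangle with at least 4 points and a complement meeting every topless rectangle with at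
  least 4 points. A rectangle with \<open>4 (3 k - 2)\<close> points can be cut by vertical lines into pieces of
  4 points, so it contains \<open>3 k - 2\<close> points of the relevant part; hence it suffices to colour \<open>D\<close> for
  bottomless and its complement for topless rectangles, separately.

  Colouring for one of the two families: sweep upwards and keep at least \<open>k - 1\<close> points between any two
  points of the same colour, a property that later points cannot destroy. If \<open>3 k - 2\<close> consecutive
  points miss a colour, the middle \<open>k\<close> of them carry each other colour at most once, so one of them is
  still uncoloured and may receive the missing colour.

  Construction of \<open>D\<close>: sweep upwards, and whenever 4 consecutive points avoid \<open>D\<close>, add one of the two
  inner ones that has a neighbour at least as high as itself. If all points of a topless rectangle
  are in \<open>D\<close>, then the one added last is leftmost or rightmost among them, and this remains true after
  removing it. Two successive additions at the same end are impossible: the low neighbour of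
  the second one would already separate it from the high neighbour of the first one. So the rectangle
  has at most 3 points.
\<close>

section \<open>Convex subsets in the order of the x-coordinate\<close>

text \<open>For finite \<open>P\<close> consisting of the points on one side of a horizontal line,
  these are the traces of bottomless or topless rectangles. Keeping no interval endpoints makes the
  notion stable under intersection with \<open>D\<close> and under reflection of
  \<open>x\<close>.\<close>

definition convex_in :: "('a \<Rightarrow> real) \<Rightarrow> 'a set \<Rightarrow> 'a set \<Rightarrow> bool" where
  "convex_in x P W \<longleftrightarrow>
     W \<subseteq> P \<and> (\<forall>u\<in>W. \<forall>v\<in>W. \<forall>z\<in>P. x u \<le> x z \<and> x z \<le> x v \<longrightarrow> z \<in> W)"

lemma convex_inD:
  "convex_in x P W \<Longrightarrow> u \<in> W \<Longrightarrow> v \<in> W \<Longrightarrow> z \<in> P \<Longrightarrow> x u \<le> x z \<Longrightarrow> x z \<le> x v \<Longrightarrow> z \<in> W"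
  unfolding convex_in_def by blast

lemma convex_in_subset: "convex_in x P W \<Longrightarrow> W \<subseteq> P"
  by (simp add: convex_in_def)

lemma convex_in_Int: "convex_in x P W \<Longrightarrow> convex_in x (P \<inter> D) (W \<inter> D)"
  by (auto simp: convex_in_def)

lemma convex_in_uminus: "convex_in (\<lambda>z. - x z) P W \<longleftrightarrow> convex_in x P W"
  by (auto simp: convex_in_def)

lemma convex_in_initial:
  assumes "convex_in x P W" "A \<subseteq> W" "\<And>u v. u \<in> A \<Longrightarrow> v \<in> W - A \<Longrightarrow> x u < x v"
  shows "convex_in x P A" "convex_in x P (W - A)"
proof -
  show "convex_in x P A"
    unfolding convex_in_def
  proof (intro conjI ballI impI)
    show "A \<subseteq> P" using assms by (auto simp: convex_in_def)
    fix u v z assume uv: "u \<in> A" "v \<in> A" "z \<in> P" "x u \<le> x z \<and> x z \<le> x v"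
    then have "z \<in> W" using assms(2) convex_inD[OF assms(1), of u v z] by auto
    then show "z \<in> A" using assms(3)[of v z] uv by fastforce
  qed
  show "convex_in x P (W - A)"
    unfolding convex_in_def
  proof (intro conjI ballI impI)
    show "W - A \<subseteq> P" using assms by (auto simp: convex_in_def)
    fix u v z assume uv: "u \<in> W - A" "v \<in> W - A" "z \<in> P" "x u \<le> x z \<and> x z \<le> x v"
    then have "z \<in> W" using convex_inD[OF assms(1), of u v z] by auto
    then show "z \<in> W - A" using assms(3)[of z u] uv by fastforce
  qed
qed

lemma initial_segment:
  fixes x :: "'a \<Rightarrow> real"
  assumes "finite W" "inj_on x W" "n \<le> card W"
  shows "\<exists>A\<subseteq>W. card A = n \<and> (\<forall>u\<in>A. \<forall>v\<in>W - A. x u < x v)"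
  using assms(3)
proof (induction n)
  case 0
  show ?case by (intro exI[of _ "{}"]) auto
next
  case (Suc n)
  then obtain A where A: "A \<subseteq> W" "card A = n" "\<And>u v. u \<in> A \<Longrightarrow> v \<in> W - A \<Longrightarrow> x u < x v"
    by fastforce
  have fin: "finite (W - A)" "finite A" using assms(1) A(1) finite_subset by auto
  have "W - A \<noteq> {}" using A(1,2) Suc.prems fin by (metis Diff_eq_empty_iff Suc_n_not_le_n subset_antisym)
  then obtain m where m: "is_arg_min x (\<lambda>z. z \<in> W - A) m"
    using ex_is_arg_min_if_finite[OF fin(1)] by blast
  have mW: "m \<in> W - A" using m by (simp add: is_arg_min_def)
  have lt: "x m < x v" if "v \<in> W - insert m A" for v
  proof -
    have "x m \<le> x v" using m that by (auto simp: is_arg_min_linorder)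
    moreover have "x m \<noteq> x v" using assms(2) mW that by (auto dest: inj_onD)
    ultimately show ?thesis by simp
  qed
  show ?case
    using A mW lt fin by (intro exI[of _ "insert m A"]) auto
qed

text \<open>Both the four leftmost points and the remaining ones are again convex, so blocks of four
  can be split off one after another, each contributing a point of \<open>D\<close>.\<close>

lemma card_Int_hitting_set:
  assumes "finite P" "inj_on x P"
    and hit: "\<And>W. convex_in x P W \<Longrightarrow> 4 \<le> card W \<Longrightarrow> W \<inter> D \<noteq> {}"
    and "convex_in x P W" "4 * n \<le> card W"
  shows "n \<le> card (W \<inter> D)"
  using assms(4,5)
proof (induction n arbitrary: W)
  case (Suc n)
  have W: "W \<subseteq> P" "finite W" "inj_on x W"
    using Suc.prems(1) assms(1,2) by (auto simp: convex_in_def intro: finite_subset inj_on_subset)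
  obtain A where A: "A \<subseteq> W" "card A = 4" "\<And>u v. u \<in> A \<Longrightarrow> v \<in> W - A \<Longrightarrow> x u < x v"
    using initial_segment[OF W(2,3), of 4] Suc.prems(2) by auto
  note conv = convex_in_initial[OF Suc.prems(1) A(1,3), simplified]
  have fA: "finite A" using A(1) W(2) finite_subset by blast
  have "n \<le> card ((W - A) \<inter> D)"
    using Suc.prems(2) A fA by (intro Suc.IH conv) (auto simp: card_Diff_subset)
  moreover have "card (A \<inter> D) \<ge> 1"
    using hit[OF conv(1)] A(2) fA by (simp add: Suc_le_eq card_gt_0_iff)
  moreover have "card (W \<inter> D) = card (A \<inter> D) + card ((W - A) \<inter> D)"
    using A(1) W(2) fA by (subst card_Un_disjoint[symmetric]) (auto intro: arg_cong[where f = card])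
  ultimately show ?case by simp
qed simp


subsection \<open>Polychromatic colourings for bottomless rectangles\<close>

text \<open>The colouring is partial because points stay uncoloured until some rectangle needs them.
  Uncoloured points count as separators too, so enlarging \<open>P\<close> can only help.\<close>

definition spaced :: "('a \<Rightarrow> real) \<Rightarrow> nat \<Rightarrow> 'a set \<Rightarrow> ('a \<rightharpoonup> nat) \<Rightarrow> bool" where
  "spaced x k P c \<longleftrightarrow> dom c \<subseteq> P \<and> ran c \<subseteq> {0..<k} \<and>
     (\<forall>p q. p \<in> dom c \<longrightarrow> c p = c q \<longrightarrow> x p < x q \<longrightarrow> k \<le> Suc (card {z \<in> P. x p < x z \<and> x z < x q}))"

lemma spaced_mono:
  assumes "spaced x k P c" "P \<subseteq> P'" "finite P'"
  shows "spaced x k P' c"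
proof -
  have "card {z \<in> P. x p < x z \<and> x z < x q} \<le> card {z \<in> P'. x p < x z \<and> x z < x q}" for p q
    using assms(2,3) by (intro card_mono) auto
  then show ?thesis
    using assms unfolding spaced_def by (meson Suc_le_mono order_trans)
qed

text \<open>As \<open>3 * k - 2 = (k - 1) + k + (k - 1)\<close>, \<open>W\<close> splits from left
  to right into \<open>A\<close>, \<open>M\<close> and \<open>B\<close>. Pigeonhole leaves an
  uncoloured point in \<open>M\<close>, and \<open>A\<close> and \<open>B\<close> keep it far enough
  from every point of colour \<open>i\<close>.\<close>

lemma spaced_extend:
  assumes P: "finite P" "inj_on x P" and c: "spaced x k P c"
    and W: "convex_in x P W" "3 * k - 2 \<le> card W" and i: "i < k" "\<And>z. z \<in> W \<Longrightarrow> c z \<noteq> Some i"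
  shows "\<exists>u\<in>P. c u = None \<and> spaced x k P (c(u \<mapsto> i))"
proof -
  have W': "W \<subseteq> P" "finite W" "inj_on x W"
    using W(1) P by (auto simp: convex_in_def intro: finite_subset inj_on_subset)
  obtain A where A: "A \<subseteq> W" "card A = k - 1" "\<And>u v. u \<in> A \<Longrightarrow> v \<in> W - A \<Longrightarrow> x u < x v"
  proof -
    have "k - 1 \<le> card W" using W(2) i(1) by linarith
    then show ?thesis using that initial_segment[OF W'(2,3)] by metis
  qed
  have fA: "finite A" using A(1) W'(2) finite_subset by blast
  have cWA: "card (W - A) \<ge> 2 * k - 1" using A fA W(2) by (auto simp: card_Diff_subset)
  obtain M where M: "M \<subseteq> W - A" "card M = k" "\<And>u v. u \<in> M \<Longrightarrow> v \<in> W - A - M \<Longrightarrow> x u < x v"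
  proof -
    have "k \<le> card (W - A)" using cWA i(1) by linarith
    moreover have "finite (W - A)" "inj_on x (W - A)" using W'(2,3) by (auto intro: inj_on_subset)
    ultimately show ?thesis using that initial_segment[of "W - A" x k] by metis
  qed
  define B where "B = W - A - M"
  have fM: "finite M" using M(1) W'(2) finite_subset by blast
  have cB: "card B \<ge> k - 1" using cWA M fM by (auto simp: B_def card_Diff_subset)
  have "\<exists>u\<in>M. c u = None"
  proof (rule ccontr)
    assume neg: "\<not> ?thesis"
    \<comment> \<open>At least \<open>k - 1\<close> points would lie between \<open>p\<close> and
      \<open>q\<close>, but all of them belong to \<open>M - {p, q}\<close>, which has only
      \<open>k - 2\<close>.\<close>
    have sep: "c p \<noteq> c q" if "p \<in> M" "q \<in> M" "x p < x q" for p q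
    proof
      assume "c p = c q"
      moreover have "p \<in> dom c" using that neg by (auto simp: dom_def)
      ultimately have "k \<le> Suc (card {z \<in> P. x p < x z \<and> x z < x q})"
        using c that(3) unfolding spaced_def by blast
      moreover have "{z \<in> P. x p < x z \<and> x z < x q} \<subseteq> M - {p, q}"
      proof
        fix z assume z: "z \<in> {z \<in> P. x p < x z \<and> x z < x q}"
        then have "z \<in> W" using convex_inD[OF W(1), of p q z] that M(1) by auto
        moreover have "z \<notin> A" using A(3)[of z p] that M(1) z by auto
        moreover have "z \<notin> W - A - M" using M(3)[of q z] that z by auto
        ultimately show "z \<in> M - {p, q}" using z by auto
      qed
      then have "card {z \<in> P. x p < x z \<and> x z < x q} \<le> card (M - {p, q})"
        using fM by (intro card_mono) auto
      moreover have pq: "card {p, q} = 2" using that by (metis card_2_iff less_irrefl)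
      moreover have "card (M - {p, q}) = k - 2"
        using that M(2) fM pq by (subst card_Diff_subset) auto
      moreover have "2 \<le> k"
      proof -
        have "card {p, q} \<le> card M" using that fM by (intro card_mono) auto
        then show ?thesis using M(2) pq by simp
      qed
      ultimately show False by simp
    qed
    have "inj_on (\<lambda>z. the (c z)) M"
    proof (rule inj_onI)
      fix p q assume pq: "p \<in> M" "q \<in> M" "the (c p) = the (c q)"
      then have "c p = c q" using neg by (metis option.expand)
      then have "x p = x q" using sep[of p q] sep[of q p] pq by fastforce
      then show "p = q" using W'(3) pq M(1) by (auto dest: inj_onD)
    qed
    moreover have "(\<lambda>z. the (c z)) ` M \<subseteq> {0..<k} - {i}"
    proof
      fix j assume "j \<in> (\<lambda>z. the (c z)) ` M"
      then obtain z where "z \<in> M" "c z = Some j" using neg by fastforce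
      then show "j \<in> {0..<k} - {i}" using c i(2)[of z] M(1) by (auto simp: spaced_def ran_def)
    qed
    ultimately have "card M \<le> card ({0..<k} - {i})" by (intro card_inj_on_le) auto
    then show False using M(2) i(1) by simp
  qed
  then obtain u where u: "u \<in> M" "c u = None" by blast
  have uW: "u \<in> W" "u \<in> P" using u M W' by auto
  \<comment> \<open>A point of colour \<open>i\<close> is outside \<open>W\<close>: if it is to the
    right of \<open>u\<close>, it is beyond all of \<open>B\<close>; in the mirrored claim
    \<open>far'\<close> it is beyond all of \<open>A\<close>.\<close>
  have far: "k \<le> Suc (card {z \<in> P. x u < x z \<and> x z < x q})"
    if q: "c q = Some i" "x u < x q" for q
  proof -
    have "q \<in> P" "q \<notin> W" using c q i(2) by (auto simp: spaced_def)
    have "B \<subseteq> {z \<in> P. x u < x z \<and> x z < x q}"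
    proof
      fix z assume z: "z \<in> B"
      then have "\<not> x q \<le> x z" using convex_inD[OF W(1), of u z q] q \<open>q \<in> P\<close> \<open>q \<notin> W\<close> uW by (auto simp: B_def)
      then show "z \<in> {z \<in> P. x u < x z \<and> x z < x q}" using z M(3)[OF u(1), of z] W' by (auto simp: B_def)
    qed
    then have "card B \<le> card {z \<in> P. x u < x z \<and> x z < x q}" using P(1) by (intro card_mono) auto
    then show ?thesis using cB by simp
  qed
  have far': "k \<le> Suc (card {z \<in> P. x q < x z \<and> x z < x u})"
    if q: "c q = Some i" "x q < x u" for q
  proof -
    have "q \<in> P" "q \<notin> W" using c q i(2) by (auto simp: spaced_def)
    have "A \<subseteq> {z \<in> P. x q < x z \<and> x z < x u}"
    proof
      fix z assume z: "z \<in> A"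
      then have "\<not> x z \<le> x q" using convex_inD[OF W(1), of z u q] q \<open>q \<in> P\<close> \<open>q \<notin> W\<close> uW A(1) by auto
      then show "z \<in> {z \<in> P. x q < x z \<and> x z < x u}" using z A(3)[of z u] A(1) W' M(1) u(1) by auto
    qed
    then have "card A \<le> card {z \<in> P. x q < x z \<and> x z < x u}" using P(1) by (intro card_mono) auto
    then show ?thesis using A(2) by simp
  qed
  have "spaced x k P (c(u \<mapsto> i))"
    using c far far' i(1) u uW unfolding spaced_def by (auto simp: ran_def split: if_splits)
  then show ?thesis using u uW by blast
qed

text \<open>Colours are added but never changed, and each use of \<open>spaced_extend\<close>
  consumes an uncoloured point of \<open>P\<close>, so the process stops.\<close>

lemma spaced_complete:
  assumes P: "finite P" "inj_on x P" and "spaced x k P c"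
  shows "\<exists>c'. c \<subseteq>\<^sub>m c' \<and> spaced x k P c' \<and>
    (\<forall>W. convex_in x P W \<longrightarrow> 3 * k - 2 \<le> card W \<longrightarrow> (\<forall>i<k. \<exists>z\<in>W. c' z = Some i))"
  using assms(3)
proof (induction "card (P - dom c)" arbitrary: c rule: less_induct)
  case less
  show ?case
  proof (cases "\<forall>W. convex_in x P W \<longrightarrow> 3 * k - 2 \<le> card W \<longrightarrow> (\<forall>i<k. \<exists>z\<in>W. c z = Some i)")
    case True
    then show ?thesis using less.prems by (intro exI[of _ c]) auto
  next
    case False
    then obtain u i where u: "u \<in> P" "c u = None" "spaced x k P (c(u \<mapsto> i))"
      using spaced_extend[OF P less.prems] by metis
    have "card (P - dom (c(u \<mapsto> i))) < card (P - dom c)"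
      using u P(1) by (intro psubset_card_mono) auto
    from less.hyps[OF this u(3)] obtain c' where
      c': "c(u \<mapsto> i) \<subseteq>\<^sub>m c'" "spaced x k P c'"
      "\<forall>W. convex_in x P W \<longrightarrow> 3 * k - 2 \<le> card W \<longrightarrow> (\<forall>i<k. \<exists>z\<in>W. c' z = Some i)" by blast
    moreover have "c \<subseteq>\<^sub>m c(u \<mapsto> i)" using u by (auto simp: map_le_def)
    ultimately show ?thesis using map_le_trans by blast
  qed
qed

text \<open>Lowering \<open>t\<close> to the largest height not above it changes nothing, so a sweep
  needs to stop only at the finitely many heights of points.\<close>

lemma level_eq:
  fixes y :: "'a \<Rightarrow> real"
  assumes "finite V" "{z \<in> V. y z \<le> t} \<noteq> {}"
  shows "\<exists>s\<in>y ` V. {z \<in> V. y z \<le> t} = {z \<in> V. y z \<le> s}"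
proof -
  let ?s = "Max (y ` {z \<in> V. y z \<le> t})"
  have s: "?s \<in> y ` {z \<in> V. y z \<le> t}" using assms by (intro Max_in) auto
  have "y z \<le> ?s" if "z \<in> V" "y z \<le> t" for z using that assms by (intro Max_ge) auto
  moreover have "?s \<le> t" using s by auto
  ultimately have "{z \<in> V. y z \<le> t} = {z \<in> V. y z \<le> ?s}" by fastforce
  then show ?thesis using s by blast
qed

lemma bottomless_colouring:
  fixes x y :: "'a \<Rightarrow> real"
  assumes V: "finite V" "inj_on x V" and k: "1 \<le> k"
  shows "\<exists>c. (\<forall>z. c z < k) \<and>
    (\<forall>t W. convex_in x {z \<in> V. y z \<le> t} W \<longrightarrow> 3 * k - 2 \<le> card W \<longrightarrow> {0..<k} \<subseteq> c ` W)"
proof -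
  let ?P = "\<lambda>t. {z \<in> V. y z \<le> t}"
  have "\<exists>c. spaced x k V c \<and> (\<forall>t\<in>y ` V. \<forall>W. convex_in x (?P t) W \<longrightarrow>
      3 * k - 2 \<le> card W \<longrightarrow> (\<forall>i<k. \<exists>z\<in>W. c z = Some i))"
  proof -
    \<comment> \<open>\<open>Y\<close> holds the levels where the sweep has already stopped. Spacing
      is claimed at every level not below them, which makes it available at the next stop.\<close>
    have "\<exists>c. (\<forall>t. (\<forall>s\<in>Y. s \<le> t) \<longrightarrow> spaced x k (?P t) c) \<and> (\<forall>t\<in>Y. \<forall>W. convex_in x (?P t) W \<longrightarrow>
      3 * k - 2 \<le> card W \<longrightarrow> (\<forall>i<k. \<exists>z\<in>W. c z = Some i))" if "finite Y" for Y
      using that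
    proof (induction Y rule: finite_linorder_max_induct)
      case empty
      show ?case by (intro exI[of _ Map.empty]) (auto simp: spaced_def)
    next
      case (insert s Y)
      then obtain c where c: "\<And>t. (\<forall>s\<in>Y. s \<le> t) \<Longrightarrow> spaced x k (?P t) c"
        "\<And>t W i. t \<in> Y \<Longrightarrow> convex_in x (?P t) W \<Longrightarrow> 3 * k - 2 \<le> card W \<Longrightarrow> i < k \<Longrightarrow> \<exists>z\<in>W. c z = Some i"
        by blast
      have "spaced x k (?P s) c" using c(1) insert.hyps by (simp add: less_imp_le)
      then obtain c' where c': "c \<subseteq>\<^sub>m c'" "spaced x k (?P s) c'"
        "\<And>W i. convex_in x (?P s) W \<Longrightarrow> 3 * k - 2 \<le> card W \<Longrightarrow> i < k \<Longrightarrow> \<exists>z\<in>W. c' z = Some i"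
      proof -
        have "finite (?P s)" "inj_on x (?P s)" using V by (auto intro: inj_on_subset)
        then show ?thesis using that spaced_complete[of "?P s" x k c] \<open>spaced x k (?P s) c\<close> by blast
      qed
      have "spaced x k (?P t) c'" if "s \<le> t" for t
        by (rule spaced_mono[OF c'(2)]) (use V(1) that in auto)
      \<comment> \<open>Levels treated earlier remain good because \<open>c'\<close> extends
        \<open>c\<close>.\<close>
      moreover have "\<exists>z\<in>W. c' z = Some i"
        if "t \<in> Y" "convex_in x (?P t) W" "3 * k - 2 \<le> card W" "i < k" for t W i
        using c(2)[OF that] c'(1) unfolding map_le_def by (metis domI)
      ultimately show ?case using c'(3) by (intro exI[of _ c']) auto
    qed
    from this[of "y ` V"] obtain c where c: "\<And>t. (\<forall>s\<in>y ` V. s \<le> t) \<Longrightarrow> spaced x k (?P t) c"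
      "\<forall>t\<in>y ` V. \<forall>W. convex_in x (?P t) W \<longrightarrow> 3 * k - 2 \<le> card W \<longrightarrow> (\<forall>i<k. \<exists>z\<in>W. c z = Some i)"
      using V(1) by blast
    have "\<forall>s\<in>y ` V. s \<le> Max (y ` V)" using V(1) by simp
    then have "spaced x k V c" using spaced_mono[OF c(1), of "Max (y ` V)" V] V(1) by auto
    then show ?thesis using c(2) by blast
  qed
  then obtain c where c: "spaced x k V c" "\<And>t W i. t \<in> y ` V \<Longrightarrow> convex_in x (?P t) W \<Longrightarrow>
      3 * k - 2 \<le> card W \<Longrightarrow> i < k \<Longrightarrow> \<exists>z\<in>W. c z = Some i"
    by blast
  \<comment> \<open>Uncoloured points get colour \<open>0\<close>, which is legal since
    \<open>1 \<le> k\<close>; the coloured points alone already supply all colours.\<close>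
  let ?c = "\<lambda>z. case c z of None \<Rightarrow> 0 | Some i \<Rightarrow> i"
  have "?c z < k" for z
    using c(1) k by (auto simp: spaced_def ran_def split: option.splits)
  moreover have "{0..<k} \<subseteq> ?c ` W" if W: "convex_in x (?P t) W" "3 * k - 2 \<le> card W" for t W
  proof
    fix i assume i: "i \<in> {0..<k}"
    have "W \<noteq> {}" using W(2) k by auto
    then obtain s where "s \<in> y ` V" "?P t = ?P s"
      using level_eq[OF V(1), of y t] convex_in_subset[OF W(1)] by blast
    then obtain z where "z \<in> W" "c z = Some i" using c(2)[of s W i] W i by auto
    then show "i \<in> ?c ` W" by force
  qed
  ultimately show ?thesis by (intro exI[of _ ?c]) auto
qed


subsection \<open>Hitting all bottomless rectangles without filling a topless one\<close>

text \<open>Here \<open>s\<close> is the height of the sweep line when \<open>q\<close> is chosen, \<open>B\<close> is the set of points chosen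
  before, and \<open>p\<close>, \<open>r\<close> are the neighbours of \<open>q\<close> among the points swept so far.\<close>

definition selected :: "('a \<Rightarrow> real) \<Rightarrow> ('a \<Rightarrow> real) \<Rightarrow> 'a set \<Rightarrow> 'a set \<Rightarrow> 'a \<Rightarrow> bool" where
  "selected x y V B q \<longleftrightarrow> (\<exists>s. B \<subseteq> {z \<in> V. y z \<le> s} \<and> q \<in> V \<and> y q \<le> s \<and>
     (\<exists>p r. p \<in> V - B \<and> r \<in> V - B \<and> y p \<le> s \<and> y r \<le> s \<and> x p < x q \<and> x q < x r \<and>
       (\<forall>z\<in>V. y z \<le> s \<longrightarrow> x z < x q \<longrightarrow> x z \<le> x p) \<and>
       (\<forall>z\<in>V. y z \<le> s \<longrightarrow> x q < x z \<longrightarrow> x r \<le> x z) \<and>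
       (y q \<le> y p \<or> y q \<le> y r)))"

text \<open>Reflection exchanges the neighbours \<open>p\<close> and \<open>r\<close>. This is what
  later turns left ends into right ends.\<close>

lemma selected_uminus:
  assumes "selected x y V B q"
  shows "selected (\<lambda>z. - x z) y V B q"
proof -
  obtain s p r where *: "B \<subseteq> {z \<in> V. y z \<le> s}" "q \<in> V" "y q \<le> s" "p \<in> V - B" "r \<in> V - B"
    "y p \<le> s" "y r \<le> s" "x p < x q" "x q < x r"
    "\<forall>z\<in>V. y z \<le> s \<longrightarrow> x z < x q \<longrightarrow> x z \<le> x p" "\<forall>z\<in>V. y z \<le> s \<longrightarrow> x q < x z \<longrightarrow> x r \<le> x z"
    "y q \<le> y p \<or> y q \<le> y r"
    using assms unfolding selected_def by blast
  show ?thesis unfolding selected_def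
    by (rule exI[of _ s], intro conjI, use * in simp, use * in simp, use * in simp,
        rule exI[of _ r], rule exI[of _ p]) (use * in auto)
qed

text \<open>The values of \<open>e\<close> record the order in which the points of \<open>D\<close> were chosen.\<close>

definition stacked :: "('a \<Rightarrow> real) \<Rightarrow> ('a \<Rightarrow> real) \<Rightarrow> 'a set \<Rightarrow> 'a set \<Rightarrow> ('a \<Rightarrow> nat) \<Rightarrow> bool" where
  "stacked x y V D e \<longleftrightarrow> D \<subseteq> V \<and> inj_on e D \<and> (\<forall>q\<in>D. selected x y V {d \<in> D. e d < e q} q)"

lemma stacked_uminus: "stacked x y V D e \<Longrightarrow> stacked (\<lambda>z. - x z) y V D e"
  by (simp add: stacked_def selected_uminus)

lemma stacked_insert:
  assumes "stacked x y V D e" "finite D" "q \<notin> D" "selected x y V D q"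
  shows "\<exists>e'. stacked x y V (insert q D) e'"
proof -
  \<comment> \<open>\<open>N\<close> exceeds all earlier times, so the points before
    \<open>q\<close> are exactly \<open>D\<close> and the predecessors of older points do not
    change.\<close>
  obtain N where N: "\<And>d. d \<in> D \<Longrightarrow> e d < N"
    using finite_nat_set_iff_bounded[of "e ` D"] assms(2) by auto
  let ?e = "e(q := N)"
  have "{d \<in> insert q D. ?e d < ?e q} = D" using N assms(3) by auto
  moreover have "{d \<in> insert q D. ?e d < ?e p} = {d \<in> D. e d < e p}" if "p \<in> D" for p
    using N[OF that] assms(3) that by auto
  moreover have "inj_on ?e (insert q D)"
  proof -
    have "inj_on ?e D" using assms(1,3) by (auto simp: stacked_def inj_on_def)
    moreover have "?e q \<notin> ?e ` D" using N assms(3) by (auto simp: image_iff split: if_splits)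
    ultimately show ?thesis using assms(3) by simp
  qed
  moreover have "q \<in> V" using assms(4) unfolding selected_def by blast
  ultimately have "stacked x y V (insert q D) ?e"
    using assms(1,3,4) unfolding stacked_def by auto
  then show ?thesis by blast
qed

text \<open>Let \<open>a\<close>, \<open>b\<close>, \<open>c\<close>, \<open>d\<close> be the four
  leftmost points of \<open>W\<close>. The lower of \<open>b\<close> and \<open>c\<close> has the
  other as a neighbour at least as high, and both its neighbours lie in \<open>W\<close>, hence
  outside \<open>D\<close>.\<close>

lemma selected_exists:
  assumes V: "finite V" "inj_on x V" and D: "D \<subseteq> {z \<in> V. y z \<le> s}"
    and W: "convex_in x {z \<in> V. y z \<le> s} W" "4 \<le> card W" "W \<inter> D = {}"
  shows "\<exists>q\<in>{z \<in> V. y z \<le> s} - D. selected x y V D q"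
proof -
  have W': "W \<subseteq> {z \<in> V. y z \<le> s}" "finite W" "inj_on x W"
    using W(1) V by (auto simp: convex_in_def intro: finite_subset inj_on_subset)
  have next_pt: "\<exists>a\<in>S. \<forall>v\<in>S - {a}. x a < x v" if "S \<subseteq> W" "S \<noteq> {}" for S
  proof -
    have "finite S" "inj_on x S" using that W' by (auto intro: finite_subset inj_on_subset)
    moreover from this have "1 \<le> card S" using that by (simp add: Suc_le_eq card_gt_0_iff)
    ultimately obtain A where A: "A \<subseteq> S" "card A = 1" "\<forall>u\<in>A. \<forall>v\<in>S - A. x u < x v"
      using initial_segment by metis
    obtain a where "A = {a}" using A(2) card_1_singletonE by blast
    then show ?thesis using A by auto
  qed
  have nonempty: "W - F \<noteq> {}" if "finite F" "card F < 4" for F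
    using that W(2) card_mono[of F W] by (metis Diff_eq_empty_iff leD le_trans)
  have "W \<noteq> {}" using nonempty[of "{}"] by simp
  then obtain a where a: "a \<in> W" "\<And>v. v \<in> W \<Longrightarrow> v \<noteq> a \<Longrightarrow> x a < x v"
    using next_pt[of W] by auto
  have "W - {a} \<noteq> {}" using nonempty[of "{a}"] by simp
  then obtain b where b: "b \<in> W" "b \<noteq> a" "\<And>v. v \<in> W \<Longrightarrow> v \<noteq> a \<Longrightarrow> v \<noteq> b \<Longrightarrow> x b < x v"
    using next_pt[of "W - {a}"] by auto
  have "W - {a, b} \<noteq> {}" using nonempty[of "{a, b}"] by (simp add: card_insert_if)
  then obtain c where c: "c \<in> W" "c \<noteq> a" "c \<noteq> b" "\<And>v. v \<in> W \<Longrightarrow> v \<noteq> a \<Longrightarrow> v \<noteq> b \<Longrightarrow> v \<noteq> c \<Longrightarrow> x c < x v"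
    using next_pt[of "W - {a, b}"] by auto
  have "W - {a, b, c} \<noteq> {}" using nonempty[of "{a, b, c}"] by (simp add: card_insert_if)
  then obtain d where d: "d \<in> W" "d \<noteq> a" "d \<noteq> b" "d \<noteq> c" "\<And>v. v \<in> W \<Longrightarrow> v \<noteq> a \<Longrightarrow> v \<noteq> b \<Longrightarrow> v \<noteq> c \<Longrightarrow> v \<noteq> d \<Longrightarrow> x d < x v"
    using next_pt[of "W - {a, b, c}"] by auto
  have ord: "x a < x b" "x b < x c" "x c < x d" using a b c d by auto
  \<comment> \<open>By convexity these points are consecutive among all points swept so far, not
    only within \<open>W\<close>.\<close>
  have gap: "\<not> (x a < x z \<and> x z < x b)" "\<not> (x b < x z \<and> x z < x c)" "\<not> (x c < x z \<and> x z < x d)"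
    if "z \<in> V" "y z \<le> s" for z
  proof -
    have zW: "x a \<le> x z \<Longrightarrow> x z \<le> x d \<Longrightarrow> z \<in> W"
      using convex_inD[OF W(1) a(1) d(1), of z] that by auto
    show "\<not> (x a < x z \<and> x z < x b)" using zW b(3)[of z] ord by fastforce
    show "\<not> (x b < x z \<and> x z < x c)" using zW c(4)[of z] ord by fastforce
    show "\<not> (x c < x z \<and> x z < x d)" using zW d(5)[of z] ord by fastforce
  qed
  have sel: "selected x y V D q"
    if "p \<in> W" "q \<in> W" "r \<in> W" "x p < x q" "x q < x r" "y q \<le> y p \<or> y q \<le> y r"
      "\<And>z. z \<in> V \<Longrightarrow> y z \<le> s \<Longrightarrow> \<not> (x p < x z \<and> x z < x q)"
      "\<And>z. z \<in> V \<Longrightarrow> y z \<le> s \<Longrightarrow> \<not> (x q < x z \<and> x z < x r)" for p q r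
  proof -
    have mem: "p \<in> V - D" "r \<in> V - D" "q \<in> V" "y p \<le> s" "y q \<le> s" "y r \<le> s"
      using that(1-3) W'(1) W(3) by auto
    have "\<forall>z\<in>V. y z \<le> s \<longrightarrow> x z < x q \<longrightarrow> x z \<le> x p" "\<forall>z\<in>V. y z \<le> s \<longrightarrow> x q < x z \<longrightarrow> x r \<le> x z"
      using that(7,8) by (meson not_le)+
    then show ?thesis
      unfolding selected_def using mem that(4-6) D by blast
  qed
  show ?thesis
  proof (cases "y b \<le> y c")
    case True
    then have "selected x y V D b" using a b c ord gap by (intro sel[of a b c]) auto
    then show ?thesis using b(1) W'(1) W(3) by blast
  next
    case False
    then have "selected x y V D c" using b c d ord gap by (intro sel[of b c d]) auto
    then show ?thesis using c(1) W'(1) W(3) by blast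
  qed
qed

lemma stacked_complete:
  assumes V: "finite V" "inj_on x V" and D: "stacked x y V D e" "D \<subseteq> {z \<in> V. y z \<le> s}"
  shows "\<exists>D' e'. D \<subseteq> D' \<and> stacked x y V D' e' \<and> D' \<subseteq> {z \<in> V. y z \<le> s} \<and>
    (\<forall>W. convex_in x {z \<in> V. y z \<le> s} W \<longrightarrow> 4 \<le> card W \<longrightarrow> W \<inter> D' \<noteq> {})"
  using D
proof (induction "card (V - D)" arbitrary: D e rule: less_induct)
  case less
  show ?case
  proof (cases "\<forall>W. convex_in x {z \<in> V. y z \<le> s} W \<longrightarrow> 4 \<le> card W \<longrightarrow> W \<inter> D \<noteq> {}")
    case True
    then show ?thesis using less.prems by blast
  next
    case False
    then obtain q where q: "q \<in> V" "y q \<le> s" "q \<notin> D" "selected x y V D q"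
      using selected_exists[OF V less.prems(2)] by auto
    have "finite D" using less.prems(2) V(1) by (auto intro: finite_subset)
    then obtain e' where e': "stacked x y V (insert q D) e'"
      using stacked_insert[OF less.prems(1) _ q(3,4)] by blast
    have "card (V - insert q D) < card (V - D)"
      using q V(1) by (intro psubset_card_mono) auto
    moreover have "insert q D \<subseteq> {z \<in> V. y z \<le> s}" using q less.prems(2) by auto
    ultimately obtain D' e'' where "insert q D \<subseteq> D'" "stacked x y V D' e''" "D' \<subseteq> {z \<in> V. y z \<le> s}"
      "\<forall>W. convex_in x {z \<in> V. y z \<le> s} W \<longrightarrow> 4 \<le> card W \<longrightarrow> W \<inter> D' \<noteq> {}"
      using less.hyps[OF _ e'] by blast
    then show ?thesis by (intro exI[of _ D'] exI[of _ e'']) auto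
  qed
qed

lemma stacked_hitting_set:
  fixes x y :: "'a \<Rightarrow> real"
  assumes V: "finite V" "inj_on x V"
  shows "\<exists>D e. stacked x y V D e \<and>
    (\<forall>t W. convex_in x {z \<in> V. y z \<le> t} W \<longrightarrow> 4 \<le> card W \<longrightarrow> W \<inter> D \<noteq> {})"
proof -
  let ?P = "\<lambda>t. {z \<in> V. y z \<le> t}"
  \<comment> \<open>Since \<open>D\<close> stays below every later level, the next stop can continue
    from it; earlier levels remain hit because \<open>D\<close> only grows.\<close>
  have "\<exists>D e. stacked x y V D e \<and> (\<forall>t. (\<forall>s\<in>Y. s \<le> t) \<longrightarrow> D \<subseteq> ?P t) \<and>
    (\<forall>t\<in>Y. \<forall>W. convex_in x (?P t) W \<longrightarrow> 4 \<le> card W \<longrightarrow> W \<inter> D \<noteq> {})" if "finite Y" for Y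
    using that
  proof (induction Y rule: finite_linorder_max_induct)
    case empty
    show ?case by (intro exI[of _ "{}"]) (auto simp: stacked_def)
  next
    case (insert s Y)
    then obtain D e where D: "stacked x y V D e" "\<And>t. (\<forall>s\<in>Y. s \<le> t) \<Longrightarrow> D \<subseteq> ?P t"
      "\<And>t W. t \<in> Y \<Longrightarrow> convex_in x (?P t) W \<Longrightarrow> 4 \<le> card W \<Longrightarrow> W \<inter> D \<noteq> {}"
      by blast
    have "D \<subseteq> ?P s" using D(2) insert.hyps by (simp add: less_imp_le)
    then obtain D' e' where D': "D \<subseteq> D'" "stacked x y V D' e'" "D' \<subseteq> ?P s"
      "\<And>W. convex_in x (?P s) W \<Longrightarrow> 4 \<le> card W \<Longrightarrow> W \<inter> D' \<noteq> {}"
      using stacked_complete[OF V D(1), of s] by blast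
    have "W \<inter> D' \<noteq> {}" if "t \<in> insert s Y" "convex_in x (?P t) W" "4 \<le> card W" for t W
      using D'(1,4) D(3)[of t W] that by blast
    moreover have "D' \<subseteq> ?P t" if "s \<le> t" for t using D'(3) that by auto
    ultimately show ?case using D'(2) by (intro exI[of _ D'] exI[of _ e']) auto
  qed
  from this[of "y ` V"] obtain D e where D: "stacked x y V D e"
    "\<And>t W. t \<in> y ` V \<Longrightarrow> convex_in x (?P t) W \<Longrightarrow> 4 \<le> card W \<Longrightarrow> W \<inter> D \<noteq> {}"
    using V(1) by blast
  have "W \<inter> D \<noteq> {}" if W: "convex_in x (?P t) W" "4 \<le> card W" for t W
  proof -
    have "W \<noteq> {}" using W(2) by auto
    then obtain s where "s \<in> y ` V" "?P t = ?P s"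
      using level_eq[OF V(1), of y t] convex_in_subset[OF W(1)] by blast
    then show ?thesis using D(2)[of s W] W by simp
  qed
  then show ?thesis using D(1) by blast
qed

section \<open>Topless rectangles and the order of choice\<close>

definition last_in :: "('a \<Rightarrow> nat) \<Rightarrow> 'a set \<Rightarrow> 'a \<Rightarrow> bool" where
  "last_in e Q z \<longleftrightarrow> z \<in> Q \<and> (\<forall>w\<in>Q - {z}. e w < e z)"

lemma last_in_exists:
  assumes "finite Q" "Q \<noteq> {}" "inj_on e Q"
  shows "\<exists>z. last_in e Q z"
proof -
  have "Max (e ` Q) \<in> e ` Q" using assms by (intro Max_in) auto
  then obtain z where z: "z \<in> Q" "e z = Max (e ` Q)" by auto
  have "e w < e z" if "w \<in> Q - {z}" for w
  proof -
    have "e w \<le> e z" using that z assms(1) by simp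
    moreover have "e w \<noteq> e z" using that z(1) assms(3) by (auto dest: inj_onD)
    ultimately show ?thesis by simp
  qed
  then show ?thesis using z(1) by (auto simp: last_in_def)
qed

text \<open>The neighbours of the last point of \<open>Q\<close> at the moment of its choice are not in \<open>Q\<close>,
  so a neighbour between two points of \<open>Q\<close> lies below the level \<open>t\<close>.\<close>

lemma last_in_neighbours:
  assumes st: "stacked x y V D e" and Q: "convex_in x {z \<in> V. t \<le> y z} Q" "Q \<subseteq> D" and z: "last_in e Q z"
  obtains s p r where "y z \<le> s" "\<And>w. w \<in> Q \<Longrightarrow> y w \<le> s"
    "p \<in> V" "r \<in> V" "y p \<le> s" "y r \<le> s" "x p < x z" "x z < x r"
    "\<And>w. w \<in> V \<Longrightarrow> y w \<le> s \<Longrightarrow> x w < x z \<Longrightarrow> x w \<le> x p"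
    "\<And>w. w \<in> V \<Longrightarrow> y w \<le> s \<Longrightarrow> x z < x w \<Longrightarrow> x r \<le> x w"
    "y z \<le> y p \<or> y z \<le> y r"
    "\<And>w. w \<in> Q \<Longrightarrow> x w < x z \<Longrightarrow> y p < t" "\<And>w. w \<in> Q \<Longrightarrow> x z < x w \<Longrightarrow> y r < t"
proof -
  let ?B = "{d \<in> D. e d < e z}"
  have zQ: "z \<in> Q" "z \<in> D" using z Q by (auto simp: last_in_def)
  have QB: "w \<in> ?B" if "w \<in> Q" "w \<noteq> z" for w using z Q that by (auto simp: last_in_def)
  have "selected x y V ?B z" using st zQ by (simp add: stacked_def)
  then obtain s p r where *: "?B \<subseteq> {z \<in> V. y z \<le> s}" "y z \<le> s" "p \<in> V - ?B" "r \<in> V - ?B"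
    "y p \<le> s" "y r \<le> s" "x p < x z" "x z < x r"
    "\<forall>w\<in>V. y w \<le> s \<longrightarrow> x w < x z \<longrightarrow> x w \<le> x p" "\<forall>w\<in>V. y w \<le> s \<longrightarrow> x z < x w \<longrightarrow> x r \<le> x w"
    "y z \<le> y p \<or> y z \<le> y r"
    unfolding selected_def by blast
  have Qs: "y w \<le> s" if "w \<in> Q" for w using QB[OF that] * by (cases "w = z") auto
  have QV: "Q \<subseteq> V" using convex_in_subset[OF Q(1)] by auto
  \<comment> \<open>All points of \<open>Q\<close> other than \<open>z\<close> are in
    \<open>?B\<close>, while \<open>p\<close> and \<open>r\<close> are neither in \<open>?B\<close>
    nor equal to \<open>z\<close>. At height at least \<open>t\<close>, a neighbour between two
    points of \<open>Q\<close> would be in \<open>Q\<close> by convexity.\<close>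
  have "p \<notin> Q" "r \<notin> Q" using QB[of p] QB[of r] * by auto
  have "y p < t" if w: "w \<in> Q" "x w < x z" for w
  proof (rule ccontr)
    assume "\<not> y p < t"
    moreover have "x w \<le> x p" using *(9) w QV Qs by auto
    ultimately show False
      using convex_inD[OF Q(1) w(1) zQ(1), of p] * \<open>p \<notin> Q\<close> by auto
  qed
  moreover have "y r < t" if w: "w \<in> Q" "x z < x w" for w
  proof (rule ccontr)
    assume "\<not> y r < t"
    moreover have "x r \<le> x w" using *(10) w QV Qs by auto
    ultimately show False
      using convex_inD[OF Q(1) zQ(1) w(1), of r] * \<open>r \<notin> Q\<close> by auto
  qed
  ultimately show ?thesis using * Qs that[of s p r] by blast
qed

text \<open>With points of \<open>Q\<close> on both sides of \<open>z\<close>, both neighbours of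
  \<open>z\<close> would lie below \<open>t \<le> y z\<close>, but one of them is at least as high
  as \<open>z\<close>.\<close>

lemma last_in_is_end:
  assumes "stacked x y V D e" "inj_on x V" "convex_in x {z \<in> V. t \<le> y z} Q" "Q \<subseteq> D" "last_in e Q z"
  shows "(\<forall>w\<in>Q. x w \<le> x z) \<or> (\<forall>w\<in>Q. x z \<le> x w)"
proof (rule ccontr)
  assume "\<not> ?thesis"
  then obtain v w where "v \<in> Q" "w \<in> Q" "x z < x v" "x w < x z" by (auto simp: not_le)
  moreover have "t \<le> y z" using assms(3,5) by (auto simp: convex_in_def last_in_def)
  ultimately show False
    using last_in_neighbours[OF assms(1,3,4,5)] by (metis leD le_less_trans)
qed

text \<open>Here \<open>b\<close> was chosen before \<open>a\<close>, and \<open>b\<close> is the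
  rightmost point of \<open>Q - {a}\<close>. \<open>R\<close> may be smaller than
  \<open>Q - {a}\<close>, so that points at the left end can be removed in between.\<close>

lemma no_two_right_ends:
  assumes st: "stacked x y V D e" and inj: "inj_on x V"
    and Q: "convex_in x {z \<in> V. t \<le> y z} Q" "Q \<subseteq> D" "last_in e Q a" "\<And>w. w \<in> Q \<Longrightarrow> x w \<le> x a"
    and R: "convex_in x {z \<in> V. t \<le> y z} R" "R \<subseteq> Q" "last_in e R b" "\<And>w. w \<in> R \<Longrightarrow> x w \<le> x b"
    and ab: "a \<noteq> b" "\<And>w. w \<in> Q \<Longrightarrow> w \<noteq> a \<Longrightarrow> x w \<le> x b" and card: "2 \<le> card R"
  shows False
proof -
  have RD: "R \<subseteq> D" using R(2) Q(2) by blast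
  have mem: "a \<in> Q" "b \<in> R" "b \<in> Q" using Q R by (auto simp: last_in_def)
  have QV: "\<And>w. w \<in> Q \<Longrightarrow> w \<in> V \<and> t \<le> y w" using convex_in_subset[OF Q(1)] by auto
  have neq: "x v \<noteq> x w" if "v \<in> V" "w \<in> V" "v \<noteq> w" for v w using inj that by (auto dest: inj_onD)
  have "x b < x a" using Q(4)[of b] neq[of a b] mem QV ab(1) by force
  \<comment> \<open>A further point of \<open>R\<close> to the left of \<open>b\<close> forces the
    left neighbour of \<open>b\<close> below \<open>t\<close>, so its right neighbour
    \<open>r\<close> must be the high one.\<close>
  obtain w where w: "w \<in> R" "w \<noteq> b"
  proof -
    have "R \<noteq> {b}" using card by auto
    then show ?thesis using that mem(2) by blast
  qed
  then have "x w < x b" using R(4)[of w] neq[of w b] mem QV R(2) by force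
  obtain s p r where B: "y b \<le> s" "r \<in> V" "x b < x r" "y b \<le> y p \<or> y b \<le> y r" "y p < t"
    "\<And>w. w \<in> V \<Longrightarrow> y w \<le> s \<Longrightarrow> x b < x w \<Longrightarrow> x r \<le> x w"
    using last_in_neighbours[OF st R(1) RD R(3)] w(1) \<open>x w < x b\<close> by metis
  obtain s' p' where A: "y b \<le> s'" "p' \<in> V" "x p' < x a" "y p' < t"
    "\<And>w. w \<in> V \<Longrightarrow> y w \<le> s' \<Longrightarrow> x w < x a \<Longrightarrow> x w \<le> x p'"
    using last_in_neighbours[OF st Q(1,2,3)] mem(3) \<open>x b < x a\<close> by metis
  have "p' \<noteq> b" using A(4) QV[OF mem(3)] by auto
  then have "x b < x p'" using A(5)[of b] neq[of b p'] A(1,2) QV[OF mem(3)] \<open>x b < x a\<close> by force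
  \<comment> \<open>Being lower than \<open>t \<le> y b \<le> s\<close>, the point \<open>p'\<close>
    was already swept when \<open>b\<close> was chosen, so it cannot lie strictly between
    \<open>b\<close> and \<open>r\<close>.\<close>
  then have "x r \<le> x p'" using B(6)[of p'] A(2,4) B(1) QV[OF mem(3)] by force
  then have "x r < x a" using A(3) by simp
  moreover have "t \<le> y r" using B(4,5) QV[OF mem(3)] by auto
  ultimately have "r \<in> Q" using convex_inD[OF Q(1) mem(3,1), of r] B(2,3) by auto
  then show False using ab(2)[of r] B(3) \<open>x r < x a\<close> by fastforce
qed

lemma no_two_left_ends:
  assumes "stacked x y V D e" "inj_on x V"
    "convex_in x {z \<in> V. t \<le> y z} Q" "Q \<subseteq> D" "last_in e Q a" "\<And>w. w \<in> Q \<Longrightarrow> x a \<le> x w"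
    "convex_in x {z \<in> V. t \<le> y z} R" "R \<subseteq> Q" "last_in e R b" "\<And>w. w \<in> R \<Longrightarrow> x b \<le> x w"
    "a \<noteq> b" "\<And>w. w \<in> Q \<Longrightarrow> w \<noteq> a \<Longrightarrow> x b \<le> x w" "2 \<le> card R"
  shows False
proof (rule no_two_right_ends[of "\<lambda>z. - x z" y V D e t Q a R b])
  show "inj_on (\<lambda>z. - x z) V" using assms(2) by (auto simp: inj_on_def)
qed (use assms in \<open>auto simp: convex_in_uminus stacked_uminus\<close>)

lemma convex_in_remove_end:
  assumes "convex_in x P Q" "inj_on x P" "z \<in> Q" "(\<forall>w\<in>Q. x w \<le> x z) \<or> (\<forall>w\<in>Q. x z \<le> x w)"
  shows "convex_in x P (Q - {z})"
proof -
  have "Q \<subseteq> P" using assms(1) by (rule convex_in_subset)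
  have "w \<noteq> z" if "u \<in> Q - {z}" "v \<in> Q - {z}" "x u \<le> x w" "x w \<le> x v" for u v w
  proof
    assume "w = z"
    then have "x u = x z \<or> x v = x z" using assms(4) that by force
    then show False using that assms(2,3) \<open>Q \<subseteq> P\<close> by (auto dest: inj_onD)
  qed
  then show ?thesis using assms(1) unfolding convex_in_def by blast
qed

text \<open>Peel off the last chosen points \<open>a\<close>, \<open>b\<close>, \<open>c\<close> in
  turn; each is an end of what remains. Four points suffice to leave two in \<open>Q2\<close>, as
  the lemmas on repeated ends require.\<close>

lemma no_topless_in_stacked:
  assumes V: "finite V" "inj_on x V" and st: "stacked x y V D e"
    and Q: "convex_in x {z \<in> V. t \<le> y z} Q" "4 \<le> card Q"
  shows "\<not> Q \<subseteq> D"
proof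
  assume QD: "Q \<subseteq> D"
  have injP: "inj_on x {z \<in> V. t \<le> y z}" using V(2) by (rule inj_on_subset) auto
  have injQ: "inj_on e Q" using st QD by (auto simp: stacked_def intro: inj_on_subset)
  have finQ: "finite Q" using Q(1) V(1) by (auto simp: convex_in_def intro: finite_subset)
  have step: "\<exists>z. last_in e S z \<and> ((\<forall>w\<in>S. x w \<le> x z) \<or> (\<forall>w\<in>S. x z \<le> x w)) \<and>
      convex_in x {z \<in> V. t \<le> y z} (S - {z}) \<and> card (S - {z}) = card S - 1"
    if S: "convex_in x {z \<in> V. t \<le> y z} S" "S \<subseteq> Q" "2 \<le> card S" for S
  proof -
    have "finite S" "inj_on e S" using S(2) finQ injQ by (auto intro: finite_subset inj_on_subset)
    moreover have "S \<noteq> {}" using S(3) by auto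
    ultimately obtain z where z: "last_in e S z" using last_in_exists by metis
    have zS: "z \<in> S" using z by (simp add: last_in_def)
    have "S \<subseteq> D" using S(2) QD by blast
    note e = last_in_is_end[OF st V(2) S(1) this z]
    show ?thesis
      using z e convex_in_remove_end[OF S(1) injP zS e] zS by auto
  qed
  obtain a where a: "last_in e Q a" "(\<forall>w\<in>Q. x w \<le> x a) \<or> (\<forall>w\<in>Q. x a \<le> x w)"
    "convex_in x {z \<in> V. t \<le> y z} (Q - {a})" "card (Q - {a}) = card Q - 1"
    using step[OF Q(1)] Q(2) by auto
  define Q1 where "Q1 = Q - {a}"
  obtain b where b: "last_in e Q1 b" "(\<forall>w\<in>Q1. x w \<le> x b) \<or> (\<forall>w\<in>Q1. x b \<le> x w)"
    "convex_in x {z \<in> V. t \<le> y z} (Q1 - {b})" "card (Q1 - {b}) = card Q1 - 1"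
  proof -
    have "2 \<le> card Q1" "Q1 \<subseteq> Q" using a(4) Q(2) by (auto simp: Q1_def)
    then show ?thesis using that step[of Q1] a(3) by (auto simp: Q1_def)
  qed
  define Q2 where "Q2 = Q1 - {b}"
  have card2: "2 \<le> card Q2" using a(4) b(4) Q(2) by (simp add: Q1_def Q2_def)
  obtain c where c: "last_in e Q2 c" "(\<forall>w\<in>Q2. x w \<le> x c) \<or> (\<forall>w\<in>Q2. x c \<le> x w)"
    using step[of Q2] b(3) card2 unfolding Q1_def Q2_def by auto
  have card1: "2 \<le> card Q1" using b(4) card2 by (simp add: Q2_def)
  have conv: "convex_in x {z \<in> V. t \<le> y z} Q1" "convex_in x {z \<in> V. t \<le> y z} Q2"
    using a(3) b(3) by (auto simp: Q1_def Q2_def)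
  have sub: "Q1 \<subseteq> D" using QD by (auto simp: Q1_def)
  have mem: "a \<in> Q" "b \<in> Q1" "c \<in> Q2" using a(1) b(1) c(1) by (auto simp: last_in_def)
  note right = no_two_right_ends[OF st V(2)] and left = no_two_left_ends[OF st V(2)]
  \<comment> \<open>Either two successive ends are on the same side, or the sides alternate. In the
    latter case \<open>b\<close> was removed at the opposite end, so \<open>c\<close> is still
    extreme in \<open>Q - {a}\<close> on the side of \<open>a\<close>.\<close>
  consider "\<forall>w\<in>Q. x w \<le> x a" "\<forall>w\<in>Q1. x w \<le> x b" | "\<forall>w\<in>Q. x a \<le> x w" "\<forall>w\<in>Q1. x b \<le> x w"
    | "\<forall>w\<in>Q1. x w \<le> x b" "\<forall>w\<in>Q2. x w \<le> x c" | "\<forall>w\<in>Q1. x b \<le> x w" "\<forall>w\<in>Q2. x c \<le> x w"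
    | "\<forall>w\<in>Q. x w \<le> x a" "\<forall>w\<in>Q1. x b \<le> x w" "\<forall>w\<in>Q2. x w \<le> x c"
    | "\<forall>w\<in>Q. x a \<le> x w" "\<forall>w\<in>Q1. x w \<le> x b" "\<forall>w\<in>Q2. x c \<le> x w"
    using a(2) b(2) c(2) by blast
  then show False
  proof cases
    case 1
    show ?thesis
      by (rule right[OF Q(1) QD a(1) _ conv(1) _ b(1) _ _ _ card1]) (use 1 mem in \<open>auto simp: Q1_def\<close>)
  next
    case 2
    show ?thesis
      by (rule left[OF Q(1) QD a(1) _ conv(1) _ b(1) _ _ _ card1]) (use 2 mem in \<open>auto simp: Q1_def\<close>)
  next
    case 3
    show ?thesis
      by (rule right[OF conv(1) sub b(1) _ conv(2) _ c(1) _ _ _ card2]) (use 3 mem in \<open>auto simp: Q2_def\<close>)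
  next
    case 4
    show ?thesis
      by (rule left[OF conv(1) sub b(1) _ conv(2) _ c(1) _ _ _ card2]) (use 4 mem in \<open>auto simp: Q2_def\<close>)
  next
    case 5
    show ?thesis
      by (rule right[OF Q(1) QD a(1) _ conv(2) _ c(1) _ _ _ card2]) (use 5 mem in \<open>auto simp: Q1_def Q2_def\<close>)
  next
    case 6
    show ?thesis
      by (rule left[OF Q(1) QD a(1) _ conv(2) _ c(1) _ _ _ card2]) (use 6 mem in \<open>auto simp: Q1_def Q2_def\<close>)
  qed
qed

section \<open>Combining the two colourings\<close>

lemma admits_poly_linear:
  assumes k: "1 \<le> k"
  shows "admits_poly (R_BL \<union> R_TL) k (4 * (3 * k - 2))"
  unfolding admits_poly_def
proof (intro allI impI)
  fix V :: "point set" assume "finite V \<and> general_position V"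
  then have V: "finite V" "inj_on fst V" by (auto simp: general_position_def)
  obtain D e where D: "stacked fst snd V D e"
    "\<And>t W. convex_in fst {z \<in> V. snd z \<le> t} W \<Longrightarrow> 4 \<le> card W \<Longrightarrow> W \<inter> D \<noteq> {}"
    using stacked_hitting_set[OF V, of snd] by blast
  have "D \<subseteq> V" using D(1) by (simp add: stacked_def)
  have U: "W \<inter> (V - D) \<noteq> {}" if "convex_in fst {z \<in> V. t \<le> snd z} W" "4 \<le> card W" for t W
    using no_topless_in_stacked[OF V D(1) that] convex_in_subset[OF that(1)] by blast
  have inj: "finite D" "inj_on fst D" "finite (V - D)" "inj_on fst (V - D)"
    using V \<open>D \<subseteq> V\<close> by (auto intro: finite_subset inj_on_subset)
  obtain c1 where c1: "\<And>z. c1 z < k" "\<And>t W. convex_in fst {z \<in> D. snd z \<le> t} W \<Longrightarrow>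
      3 * k - 2 \<le> card W \<Longrightarrow> {0..<k} \<subseteq> c1 ` W"
    using bottomless_colouring[OF inj(1,2) k, of snd] by blast
  \<comment> \<open>Negating the height turns topless rectangles into bottomless ones.\<close>
  obtain c2 where c2: "\<And>z. c2 z < k" "\<And>t W. convex_in fst {z \<in> V - D. - snd z \<le> t} W \<Longrightarrow>
      3 * k - 2 \<le> card W \<Longrightarrow> {0..<k} \<subseteq> c2 ` W"
    using bottomless_colouring[OF inj(3,4) k, of "\<lambda>z. - snd z"] by blast
  define c where "c z = (if z \<in> D then c1 z else c2 z)" for z
  have "{0..<k} \<subseteq> c ` E" if "E \<in> hyperedges V (R_BL \<union> R_TL) (4 * (3 * k - 2))" for E
  proof -
    obtain S where S: "S \<in> R_BL \<union> R_TL" "E = V \<inter> S" "card E = 4 * (3 * k - 2)"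
      using \<open>E \<in> _\<close> by (auto simp: hyperedges_def)
    show ?thesis
    proof (cases "S \<in> R_BL")
      case True
      then obtain a1 a2 b where ab: "S = {(x, y). a1 \<le> x \<and> x \<le> a2 \<and> y \<le> b}" by (auto simp: R_BL_def)
      let ?P = "{z \<in> V. snd z \<le> b}"
      have conv: "convex_in fst ?P E" unfolding S(2) ab convex_in_def by auto
      have "3 * k - 2 \<le> card (E \<inter> D)"
        using V S(3) by (intro card_Int_hitting_set[OF _ _ D(2) conv]) (auto intro: inj_on_subset)
      moreover have "?P \<inter> D = {z \<in> D. snd z \<le> b}" using \<open>D \<subseteq> V\<close> by auto
      ultimately have "{0..<k} \<subseteq> c1 ` (E \<inter> D)" using c1(2) convex_in_Int[OF conv, of D] by auto
      then show ?thesis by (fastforce simp: c_def)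
    next
      case False
      then obtain a1 a2 b where ab: "S = {(x, y). a1 \<le> x \<and> x \<le> a2 \<and> y \<ge> b}"
        using S(1) by (auto simp: R_TL_def)
      let ?P = "{z \<in> V. b \<le> snd z}"
      have conv: "convex_in fst ?P E" unfolding S(2) ab convex_in_def by auto
      have "3 * k - 2 \<le> card (E \<inter> (V - D))"
        using V S(3) by (intro card_Int_hitting_set[OF _ _ U conv]) (auto intro: inj_on_subset)
      moreover have "?P \<inter> (V - D) = {z \<in> V - D. - snd z \<le> - b}" by auto
      ultimately have "{0..<k} \<subseteq> c2 ` (E \<inter> (V - D))"
        using c2(2)[of "- b" "E \<inter> (V - D)"] convex_in_Int[OF conv, of "V - D"] by metis
      then show ?thesis by (fastforce simp: c_def)
    qed
  qed
  then have "polychromatic V (hyperedges V (R_BL \<union> R_TL) (4 * (3 * k - 2))) k c"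
    using c1(1) c2(1) by (auto simp: polychromatic_def c_def)
  then show "\<exists>c. polychromatic V (hyperedges V (R_BL \<union> R_TL) (4 * (3 * k - 2))) k c" by blast
qed

theorem theorem11:
  shows "\<exists>C::real. \<forall>k::nat. k \<ge> 1 \<longrightarrow>
           (\<exists>m. admits_poly (R_BL \<union> R_TL) k m) \<and>
           real (m_R (R_BL \<union> R_TL) k) \<le> C * real k powr 8.75"
proof (rule exI[of _ 12], intro allI impI conjI)
  fix k :: nat assume k: "k \<ge> 1"
  show "\<exists>m. admits_poly (R_BL \<union> R_TL) k m" using admits_poly_linear[OF k] by blast
  have "m_R (R_BL \<union> R_TL) k \<le> 4 * (3 * k - 2)"
    unfolding m_R_def by (rule Least_le) (rule admits_poly_linear[OF k])
  \<comment> \<open>The constant comes from \<open>4 * (3 * k - 2) \<le> 12 * k\<close>; then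
    \<open>k \<ge> 1\<close> allows the exponent to be raised.\<close>
  then have "real (m_R (R_BL \<union> R_TL) k) \<le> 12 * real k powr 1" using k by simp
  also have "\<dots> \<le> 12 * real k powr 8.75" using k by (intro mult_left_mono powr_mono) auto
  finally show "real (m_R (R_BL \<union> R_TL) k) \<le> 12 * real k powr 8.75" .
qed

end
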